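(* Let $R$ be an associative ring with unity, $\sigma\in End(R)$, and let $M_R$ be a right $R$-module which is semicommutative and $\sigma$-compatible. Then the following are equivalent: (1) $M_R$ is p.p.; (2) $M_R$ is p.q.-Baer; (3) $M[x;\sigma]_{R[x;\sigma]}$ is p.p.; (4) $M[x;\sigma]_{R[x;\sigma]}$ is p.q.-Baer.
   Context: Rings are associative with unity and modules are unitary right modules. $End(R)$ is the set of ring endomorphisms $\sigma$ of $R$ with $\sigma(1)=1$. For a right $S$-module $N$ and $X\subseteq N$, $r_S(X)=\{a\in S: Xa=0\}$; for $n\in N$, $r_S(n)=r_S(\{n\})$. A module $N_S$ (over any ring $S$) is p.p. if for every $n\in N$ there is an idempotent $e^2=e\in S$ with $r_S(n)=eS$; it is p.q.-Baer if for every $n\in N$ there is an idempotent $e^2=e\in S$ with $r_S(nS)=eS$. $M_R$ is semicommutative if for all $m\in M$, $a\in R$: $ma=0$ implies $mRa=0$. $M_R$ is $\sigma$-compatible if for all $m\in M$, $a\in R$: $ma=0$ if and only if $m\sigma(a)=0$. $R[x;\sigma]$ is the skew polynomial ring (coefficients on the left, $xa=\sigma(a)x$). $M[x;\sigma]=\{\sum_{i=0}^s m_ix^i: s\ge 0, m_i\in M\}$ is a right $R[x;\sigma]$-module with the obvious addition and the scalar product $\left(\sum_{i} m_ix^i\right)\left(\sum_{j} a_jx^j\right)=\sum_{k}\left(\sum_{i+j=k}m_i\sigma^i(a_j)\right)x^k$. *)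

theory Defs
  imports "HOL-Algebra.UnivPoly"
begin

section \<open>Right modules\<close>

text \<open>
  The library locale \<^locale>\<open>module\<close> covers left modules over commutative rings only, so unitary
  right modules over arbitrary rings are introduced here.  As for the library record of the same
  shape, the multiplicative fields inherited from the ring record carry no meaning for modules.
\<close>

record ('r, 'm) rmodule = "'m ring" +
  rsmult :: "['m, 'r] \<Rightarrow> 'm" (infixl \<open>\<cdot>\<index>\<close> 70)

locale right_module = R?: ring R + M?: abelian_group M
  for R (structure) and M :: "('r, 'm, 'c) rmodule_scheme" (structure) +
  assumes rsmult_closed:
      "\<lbrakk>x \<in> carrier M; a \<in> carrier R\<rbrakk> \<Longrightarrow> x \<cdot>\<^bsub>M\<^esub> a \<in> carrier M"
    and rsmult_add_module:
      "\<lbrakk>x \<in> carrier M; y \<in> carrier M; a \<in> carrier R\<rbrakk>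
        \<Longrightarrow> (x \<oplus>\<^bsub>M\<^esub> y) \<cdot>\<^bsub>M\<^esub> a = x \<cdot>\<^bsub>M\<^esub> a \<oplus>\<^bsub>M\<^esub> y \<cdot>\<^bsub>M\<^esub> a"
    and rsmult_add_ring:
      "\<lbrakk>x \<in> carrier M; a \<in> carrier R; b \<in> carrier R\<rbrakk>
        \<Longrightarrow> x \<cdot>\<^bsub>M\<^esub> (a \<oplus>\<^bsub>R\<^esub> b) = x \<cdot>\<^bsub>M\<^esub> a \<oplus>\<^bsub>M\<^esub> x \<cdot>\<^bsub>M\<^esub> b"
    and rsmult_assoc:
      "\<lbrakk>x \<in> carrier M; a \<in> carrier R; b \<in> carrier R\<rbrakk>
        \<Longrightarrow> x \<cdot>\<^bsub>M\<^esub> (a \<otimes>\<^bsub>R\<^esub> b) = (x \<cdot>\<^bsub>M\<^esub> a) \<cdot>\<^bsub>M\<^esub> b"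
    and rsmult_one:
      "x \<in> carrier M \<Longrightarrow> x \<cdot>\<^bsub>M\<^esub> \<one>\<^bsub>R\<^esub> = x"

definition right_ann ::
    "('r, 'b) ring_scheme \<Rightarrow> ('r, 'm, 'c) rmodule_scheme \<Rightarrow> 'm set \<Rightarrow> 'r set"
  where "right_ann S N X = {a \<in> carrier S. \<forall>x\<in>X. x \<cdot>\<^bsub>N\<^esub> a = \<zero>\<^bsub>N\<^esub>}"

definition cyclic_submodule ::
    "('r, 'b) ring_scheme \<Rightarrow> ('r, 'm, 'c) rmodule_scheme \<Rightarrow> 'm \<Rightarrow> 'm set"
  where "cyclic_submodule S N n = {n \<cdot>\<^bsub>N\<^esub> s | s. s \<in> carrier S}"

text \<open>The library notation \<open>e <#\<^bsub>S\<^esub> carrier S\<close> denotes the right ideal \<open>eS\<close>.\<close>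

definition pp_module :: "('r, 'b) ring_scheme \<Rightarrow> ('r, 'm, 'c) rmodule_scheme \<Rightarrow> bool"
  where "pp_module S N \<longleftrightarrow>
    (\<forall>n\<in>carrier N. \<exists>e\<in>carrier S. e \<otimes>\<^bsub>S\<^esub> e = e \<and>
      right_ann S N {n} = e <#\<^bsub>S\<^esub> carrier S)"

definition pq_Baer_module :: "('r, 'b) ring_scheme \<Rightarrow> ('r, 'm, 'c) rmodule_scheme \<Rightarrow> bool"
  where "pq_Baer_module S N \<longleftrightarrow>
    (\<forall>n\<in>carrier N. \<exists>e\<in>carrier S. e \<otimes>\<^bsub>S\<^esub> e = e \<and>
      right_ann S N (cyclic_submodule S N n) = e <#\<^bsub>S\<^esub> carrier S)"

definition semicommutative_module ::
    "('r, 'b) ring_scheme \<Rightarrow> ('r, 'm, 'c) rmodule_scheme \<Rightarrow> bool"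
  where "semicommutative_module R M \<longleftrightarrow>
    (\<forall>m\<in>carrier M. \<forall>a\<in>carrier R. m \<cdot>\<^bsub>M\<^esub> a = \<zero>\<^bsub>M\<^esub> \<longrightarrow>
      (\<forall>r\<in>carrier R. m \<cdot>\<^bsub>M\<^esub> r \<cdot>\<^bsub>M\<^esub> a = \<zero>\<^bsub>M\<^esub>))"

definition compatible_module ::
    "('r, 'b) ring_scheme \<Rightarrow> ('r \<Rightarrow> 'r) \<Rightarrow> ('r, 'm, 'c) rmodule_scheme \<Rightarrow> bool"
  where "compatible_module R \<sigma> M \<longleftrightarrow>
    (\<forall>m\<in>carrier M. \<forall>a\<in>carrier R.
      m \<cdot>\<^bsub>M\<^esub> a = \<zero>\<^bsub>M\<^esub> \<longleftrightarrow> m \<cdot>\<^bsub>M\<^esub> \<sigma> a = \<zero>\<^bsub>M\<^esub>)"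

section \<open>Skew polynomials\<close>

text \<open>
  As in the library construction of univariate polynomials, polynomials are their coefficient
  sequences, and \<^const>\<open>up\<close> is the set of finitely supported sequences; it only uses the carrier
  and the zero, so it applies to modules as well.  The product is the one determined by
  \<open>x a = \<sigma>(a) x\<close>, i.e. \<open>(a x\<^sup>i) (b x\<^sup>j) = a \<sigma>\<^sup>i(b) x\<^sup>i\<^sup>+\<^sup>j\<close>.
\<close>

definition skew_poly_ring ::
    "('r, 'b) ring_scheme \<Rightarrow> ('r \<Rightarrow> 'r) \<Rightarrow> (nat \<Rightarrow> 'r) ring"
  where "skew_poly_ring R \<sigma> = \<lparr>
    carrier = up R,
    mult = (\<lambda>p q k. \<Oplus>\<^bsub>R\<^esub>i\<in>{..k}. p i \<otimes>\<^bsub>R\<^esub> (\<sigma> ^^ i) (q (k - i))),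
    one = (\<lambda>k. if k = 0 then \<one>\<^bsub>R\<^esub> else \<zero>\<^bsub>R\<^esub>),
    zero = (\<lambda>k. \<zero>\<^bsub>R\<^esub>),
    add = (\<lambda>p q k. p k \<oplus>\<^bsub>R\<^esub> q k)\<rparr>"

definition skew_poly_module ::
    "('r \<Rightarrow> 'r) \<Rightarrow> ('r, 'm, 'c) rmodule_scheme \<Rightarrow> (nat \<Rightarrow> 'r, nat \<Rightarrow> 'm) rmodule"
  where "skew_poly_module \<sigma> M = \<lparr>
    carrier = up M,
    mult = undefined,
    one = undefined,
    zero = (\<lambda>k. \<zero>\<^bsub>M\<^esub>),
    add = (\<lambda>p q k. p k \<oplus>\<^bsub>M\<^esub> q k),
    rsmult = (\<lambda>p q k. \<Oplus>\<^bsub>M\<^esub>i\<in>{..k}. p i \<cdot>\<^bsub>M\<^esub> (\<sigma> ^^ i) (q (k - i)))\<rparr>"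

end

theory Submission
  imports Defs
begin

text \<open>
  By semicommutativity \<open>r(n) = r(nR)\<close> for every \<open>n \<in> M\<close>, and idempotents act centrally:
  \<open>m r e = m e r\<close>.  If annihilators in \<open>M\<close> are generated by idempotents, this forces the
  Armendariz property: \<open>p f = 0\<close> in \<open>M[x;\<sigma>]\<close> if and only if \<open>p\<^sub>i f\<^sub>j = 0\<close> for all \<open>i, j\<close>.  Hence
  \<open>r(p) = r(p S)\<close> for \<open>S = R[x;\<sigma>]\<close>, and this is generated by the constant idempotent generating the
  finite intersection of the two-sided ideals \<open>r(p\<^sub>i)\<close>.  Conversely, for a constant \<open>m\<close>, the
  constant term of an idempotent generating \<open>r\<^sub>S(m)\<close> generates \<open>r\<^sub>R(m)\<close>.
\<close>

section \<open>Arithmetic in right modules\<close>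

context right_module
begin

lemma zero_rsmult [simp]:
  assumes "a \<in> carrier R"
  shows "\<zero>\<^bsub>M\<^esub> \<cdot>\<^bsub>M\<^esub> a = \<zero>\<^bsub>M\<^esub>"
proof -
  have c: "\<zero>\<^bsub>M\<^esub> \<cdot>\<^bsub>M\<^esub> a \<in> carrier M"
    using assms by (simp add: rsmult_closed)
  have "\<zero>\<^bsub>M\<^esub> \<cdot>\<^bsub>M\<^esub> a \<oplus>\<^bsub>M\<^esub> \<zero>\<^bsub>M\<^esub> \<cdot>\<^bsub>M\<^esub> a = (\<zero>\<^bsub>M\<^esub> \<oplus>\<^bsub>M\<^esub> \<zero>\<^bsub>M\<^esub>) \<cdot>\<^bsub>M\<^esub> a"
    using assms by (simp add: rsmult_add_module del: M.l_zero M.r_zero)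
  then show ?thesis
    using c by simp
qed

lemma rsmult_zero [simp]:
  assumes "m \<in> carrier M"
  shows "m \<cdot>\<^bsub>M\<^esub> \<zero>\<^bsub>R\<^esub> = \<zero>\<^bsub>M\<^esub>"
proof -
  have c: "m \<cdot>\<^bsub>M\<^esub> \<zero>\<^bsub>R\<^esub> \<in> carrier M"
    using assms by (simp add: rsmult_closed)
  have "m \<cdot>\<^bsub>M\<^esub> \<zero>\<^bsub>R\<^esub> \<oplus>\<^bsub>M\<^esub> m \<cdot>\<^bsub>M\<^esub> \<zero>\<^bsub>R\<^esub> = m \<cdot>\<^bsub>M\<^esub> (\<zero>\<^bsub>R\<^esub> \<oplus>\<^bsub>R\<^esub> \<zero>\<^bsub>R\<^esub>)"
    using assms by (simp add: rsmult_add_ring del: R.l_zero R.r_zero)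
  then show ?thesis
    using c by simp
qed

text \<open>Rewrites "\<open>a\<close> fixes \<open>m\<close>" as an annihilation, the form in which
  semicommutativity can be applied.\<close>

lemma rsmult_one_minus_eq_zero_iff:
  assumes "m \<in> carrier M" "a \<in> carrier R"
  shows "m \<cdot>\<^bsub>M\<^esub> (\<one>\<^bsub>R\<^esub> \<ominus>\<^bsub>R\<^esub> a) = \<zero>\<^bsub>M\<^esub> \<longleftrightarrow> m \<cdot>\<^bsub>M\<^esub> a = m"
proof -
  have "m \<cdot>\<^bsub>M\<^esub> (\<one>\<^bsub>R\<^esub> \<ominus>\<^bsub>R\<^esub> a) \<oplus>\<^bsub>M\<^esub> m \<cdot>\<^bsub>M\<^esub> a = m \<cdot>\<^bsub>M\<^esub> ((\<one>\<^bsub>R\<^esub> \<ominus>\<^bsub>R\<^esub> a) \<oplus>\<^bsub>R\<^esub> a)"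
    using assms by (simp add: rsmult_add_ring)
  also have "(\<one>\<^bsub>R\<^esub> \<ominus>\<^bsub>R\<^esub> a) \<oplus>\<^bsub>R\<^esub> a = \<one>\<^bsub>R\<^esub>"
    using assms by (simp add: R.minus_eq R.a_assoc R.l_neg)
  finally have "m \<cdot>\<^bsub>M\<^esub> (\<one>\<^bsub>R\<^esub> \<ominus>\<^bsub>R\<^esub> a) \<oplus>\<^bsub>M\<^esub> m \<cdot>\<^bsub>M\<^esub> a = m"
    using assms by (simp add: rsmult_one)
  moreover have "m \<cdot>\<^bsub>M\<^esub> (\<one>\<^bsub>R\<^esub> \<ominus>\<^bsub>R\<^esub> a) \<in> carrier M" "m \<cdot>\<^bsub>M\<^esub> a \<in> carrier M"
    using assms by (simp_all add: rsmult_closed)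
  ultimately show ?thesis
    using assms(1) M.add.r_cancel_one' M.l_zero by metis
qed

lemma finsum_rsmult:
  assumes "a \<in> carrier R" "finite A" "f \<in> A \<rightarrow> carrier M"
  shows "(\<Oplus>\<^bsub>M\<^esub>i\<in>A. f i) \<cdot>\<^bsub>M\<^esub> a = (\<Oplus>\<^bsub>M\<^esub>i\<in>A. f i \<cdot>\<^bsub>M\<^esub> a)"
  using assms(2,3)
proof (induction A rule: finite_induct)
  case empty
  then show ?case using assms(1) by simp
next
  case (insert x F)
  then have f: "f x \<in> carrier M" "f \<in> F \<rightarrow> carrier M" by auto
  then have "(\<lambda>i. f i \<cdot>\<^bsub>M\<^esub> a) \<in> F \<rightarrow> carrier M"
    using assms(1) by (auto intro: rsmult_closed)
  then show ?case
    using insert f assms(1) by (simp add: rsmult_add_module rsmult_closed)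
qed

end

section \<open>Sums with at most one nonzero term, and constant polynomials\<close>

lemma (in abelian_monoid) finsum_eq_single:
  assumes "finite A" "i \<in> A" "f i \<in> carrier G" "\<And>j. j \<in> A \<Longrightarrow> j \<noteq> i \<Longrightarrow> f j = \<zero>"
  shows "(\<Oplus>j\<in>A. f j) = f i"
proof -
  have "(\<Oplus>j\<in>A. f j) = (\<Oplus>j\<in>A. if i = j then f i else \<zero>)"
    using assms by (intro finsum_cong') auto
  also have "\<dots> = f i"
    using finsum_singleton[of i A "\<lambda>_. f i"] assms by auto
  finally show ?thesis .
qed

lemma (in abelian_monoid) finsum_eq_zero:
  assumes "\<And>j. j \<in> A \<Longrightarrow> f j = \<zero>"
  shows "(\<Oplus>j\<in>A. f j) = \<zero>"
  using finsum_cong'[of A A "\<lambda>_. \<zero>" f] assms by simp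

text \<open>Stated for any extension of the ring record, since only the zero enters: it yields
  constants of both R[x;\<sigma>] and M[x;\<sigma>].\<close>

definition const_poly :: "('a, 'b) ring_scheme \<Rightarrow> 'a \<Rightarrow> nat \<Rightarrow> 'a"
  where "const_poly R a = (\<lambda>k. if k = 0 then a else \<zero>\<^bsub>R\<^esub>)"

lemma const_poly_closed:
  assumes "a \<in> carrier R" "\<zero>\<^bsub>R\<^esub> \<in> carrier R"
  shows "const_poly R a \<in> up R"
  using assms by (auto simp: const_poly_def up_def bound_def)

lemma up_coeff_closed: "p \<in> up R \<Longrightarrow> p i \<in> carrier R"
  by (auto simp: up_def)

lemma up_boundE:
  assumes "p \<in> up R"
  obtains n where "\<And>i. n < i \<Longrightarrow> p i = \<zero>\<^bsub>R\<^esub>"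
proof -
  obtain n where "bound \<zero>\<^bsub>R\<^esub> n p" using assms by (auto simp: up_def)
  then show thesis using that by (auto simp: bound_def)
qed

section \<open>Semicommutativity, compatibility and idempotents\<close>

locale semicommutative_compatible_module = right_module R M
  for R (structure) and M :: "('r, 'm, 'c) rmodule_scheme" (structure) +
  fixes \<sigma> :: "'r \<Rightarrow> 'r"
  assumes hom: "\<sigma> \<in> ring_hom R R"
    and semicommutative: "semicommutative_module R M"
    and compatible: "compatible_module R \<sigma> M"
begin

abbreviation S where "S \<equiv> skew_poly_ring R \<sigma>"
abbreviation N where "N \<equiv> skew_poly_module \<sigma> M"

lemma pow_closed [simp]: "a \<in> carrier R \<Longrightarrow> (\<sigma> ^^ i) a \<in> carrier R"
  by (induction i) (auto intro: ring_hom_closed[OF hom])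

lemma pow_zero [simp]: "(\<sigma> ^^ i) \<zero>\<^bsub>R\<^esub> = \<zero>\<^bsub>R\<^esub>"
  by (induction i) (simp_all add: ring_hom_zero[OF hom R.ring_axioms R.ring_axioms])

lemma pow_one [simp]: "(\<sigma> ^^ i) \<one>\<^bsub>R\<^esub> = \<one>\<^bsub>R\<^esub>"
  by (induction i) (simp_all add: ring_hom_one[OF hom])

text \<open>Iterated compatibility: it removes the powers of \<sigma> from the summands of a skew
  product when these are tested for zero.\<close>

lemma pow_compatible:
  assumes "m \<in> carrier M" "a \<in> carrier R"
  shows "m \<cdot>\<^bsub>M\<^esub> (\<sigma> ^^ i) a = \<zero>\<^bsub>M\<^esub> \<longleftrightarrow> m \<cdot>\<^bsub>M\<^esub> a = \<zero>\<^bsub>M\<^esub>"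
  using assms compatible
  by (induction i) (auto simp: compatible_module_def)

lemma insert_factor:
  assumes "m \<in> carrier M" "a \<in> carrier R" "r \<in> carrier R" "m \<cdot>\<^bsub>M\<^esub> a = \<zero>\<^bsub>M\<^esub>"
  shows "m \<cdot>\<^bsub>M\<^esub> r \<cdot>\<^bsub>M\<^esub> a = \<zero>\<^bsub>M\<^esub>"
  using assms semicommutative by (auto simp: semicommutative_module_def)

text \<open>With \<open>f = 1 - e\<close>, both \<open>m e f\<close> and \<open>m f e\<close>
  vanish. Inserting \<open>r\<close> by semicommutativity gives \<open>m e r f = 0\<close> and
  \<open>m f r e = 0\<close>, that is, \<open>m e r e = m e r\<close>; splitting
  \<open>m = m f + m e\<close> then yields \<open>m r e = m e r e\<close>.\<close>

lemma idempotent_acts_centrally: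
  assumes m: "m \<in> carrier M" and r: "r \<in> carrier R"
    and e: "e \<in> carrier R" "e \<otimes>\<^bsub>R\<^esub> e = e"
  shows "m \<cdot>\<^bsub>M\<^esub> r \<cdot>\<^bsub>M\<^esub> e = m \<cdot>\<^bsub>M\<^esub> e \<cdot>\<^bsub>M\<^esub> r"
proof -
  let ?f = "\<one>\<^bsub>R\<^esub> \<ominus>\<^bsub>R\<^esub> e"
  have f: "?f \<in> carrier R" using e by simp
  have me: "m \<cdot>\<^bsub>M\<^esub> e \<in> carrier M" "m \<cdot>\<^bsub>M\<^esub> ?f \<in> carrier M" "m \<cdot>\<^bsub>M\<^esub> r \<in> carrier M"
    using m e f r by (auto intro: rsmult_closed)
  have "m \<cdot>\<^bsub>M\<^esub> e \<cdot>\<^bsub>M\<^esub> e = m \<cdot>\<^bsub>M\<^esub> e"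
    using m e by (simp flip: rsmult_assoc)
  then have "m \<cdot>\<^bsub>M\<^esub> e \<cdot>\<^bsub>M\<^esub> ?f = \<zero>\<^bsub>M\<^esub>"
    using me e by (simp add: rsmult_one_minus_eq_zero_iff)
  then have "m \<cdot>\<^bsub>M\<^esub> e \<cdot>\<^bsub>M\<^esub> r \<cdot>\<^bsub>M\<^esub> ?f = \<zero>\<^bsub>M\<^esub>"
    using insert_factor me f r by blast
  then have 1: "m \<cdot>\<^bsub>M\<^esub> e \<cdot>\<^bsub>M\<^esub> r \<cdot>\<^bsub>M\<^esub> e = m \<cdot>\<^bsub>M\<^esub> e \<cdot>\<^bsub>M\<^esub> r"
    using me e r by (simp add: rsmult_one_minus_eq_zero_iff rsmult_closed)
  have "?f \<otimes>\<^bsub>R\<^esub> e = \<zero>\<^bsub>R\<^esub>"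
    using e by (simp add: R.minus_eq R.l_distr R.l_minus R.r_neg)
  then have "m \<cdot>\<^bsub>M\<^esub> ?f \<cdot>\<^bsub>M\<^esub> e = \<zero>\<^bsub>M\<^esub>"
    using m e f by (simp flip: rsmult_assoc)
  then have 2: "m \<cdot>\<^bsub>M\<^esub> ?f \<cdot>\<^bsub>M\<^esub> r \<cdot>\<^bsub>M\<^esub> e = \<zero>\<^bsub>M\<^esub>"
    using insert_factor me e r by blast
  have "?f \<oplus>\<^bsub>R\<^esub> e = \<one>\<^bsub>R\<^esub>"
    using e by (simp add: R.minus_eq R.a_assoc R.l_neg)
  then have "m = m \<cdot>\<^bsub>M\<^esub> ?f \<oplus>\<^bsub>M\<^esub> m \<cdot>\<^bsub>M\<^esub> e"
    using m e f rsmult_add_ring[OF m f e(1)] by (simp add: rsmult_one)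
  then have "m \<cdot>\<^bsub>M\<^esub> r \<cdot>\<^bsub>M\<^esub> e = (m \<cdot>\<^bsub>M\<^esub> ?f \<oplus>\<^bsub>M\<^esub> m \<cdot>\<^bsub>M\<^esub> e) \<cdot>\<^bsub>M\<^esub> r \<cdot>\<^bsub>M\<^esub> e"
    by simp
  also have "\<dots> = m \<cdot>\<^bsub>M\<^esub> e \<cdot>\<^bsub>M\<^esub> r \<cdot>\<^bsub>M\<^esub> e"
    using me e r 2 by (simp add: rsmult_add_module rsmult_closed)
  finally show ?thesis using 1 by simp
qed

section \<open>Coefficients of skew products\<close>

lemma N_coeff: "(p \<cdot>\<^bsub>N\<^esub> f) k = (\<Oplus>\<^bsub>M\<^esub>i\<in>{..k}. p i \<cdot>\<^bsub>M\<^esub> (\<sigma> ^^ i) (f (k - i)))"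
  by (simp add: skew_poly_module_def)

lemma S_coeff: "(f \<otimes>\<^bsub>S\<^esub> g) k = (\<Oplus>\<^bsub>R\<^esub>i\<in>{..k}. f i \<otimes>\<^bsub>R\<^esub> (\<sigma> ^^ i) (g (k - i)))"
  by (simp add: skew_poly_ring_def)

lemma carrier_S [simp]: "carrier S = up R"
  by (simp add: skew_poly_ring_def)

lemma carrier_N [simp]: "carrier N = up M"
  by (simp add: skew_poly_module_def)

lemma zero_N: "\<zero>\<^bsub>N\<^esub> = (\<lambda>k. \<zero>\<^bsub>M\<^esub>)"
  by (simp add: skew_poly_module_def)

lemma const_mult_coeff:
  assumes "a \<in> carrier R" "f \<in> up R"
  shows "(const_poly R a \<otimes>\<^bsub>S\<^esub> f) k = a \<otimes>\<^bsub>R\<^esub> f k"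
  unfolding S_coeff using assms
  by (subst R.finsum_eq_single[of _ 0]) (auto simp: const_poly_def up_coeff_closed)

lemma const_rsmult_coeff:
  assumes "m \<in> carrier M" "f \<in> up R"
  shows "(const_poly M m \<cdot>\<^bsub>N\<^esub> f) k = m \<cdot>\<^bsub>M\<^esub> f k"
  unfolding N_coeff using assms
  by (subst M.finsum_eq_single[of _ 0]) (auto simp: const_poly_def up_coeff_closed rsmult_closed)

lemma mult_coeff_0:
  assumes "f \<in> up R" "g \<in> up R"
  shows "(f \<otimes>\<^bsub>S\<^esub> g) 0 = f 0 \<otimes>\<^bsub>R\<^esub> g 0"
  using assms by (simp add: S_coeff up_coeff_closed)

text \<open>Places \<open>p\<close> in its own cyclic submodule; the surviving summand is
  \<open>p k\<close> times \<sigma>^k(1) = 1.\<close>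

lemma rsmult_const_one:
  assumes "p \<in> up M"
  shows "p \<cdot>\<^bsub>N\<^esub> const_poly R \<one>\<^bsub>R\<^esub> = p"
proof
  fix k
  show "(p \<cdot>\<^bsub>N\<^esub> const_poly R \<one>\<^bsub>R\<^esub>) k = p k"
    unfolding N_coeff using assms
    by (subst M.finsum_eq_single[of _ k])
      (auto simp: const_poly_def up_coeff_closed rsmult_closed rsmult_one)
qed

text \<open>The condition on \<open>p\<close> is pointwise so that a product \<open>p g\<close> can
  take its place once its coefficients are known to lie in M.\<close>

lemma rsmult_eq_zero_if_coeffs:
  assumes p: "\<And>i. p i \<in> carrier M" and f: "f \<in> up R"
    and z: "\<And>i j. p i \<cdot>\<^bsub>M\<^esub> f j = \<zero>\<^bsub>M\<^esub>"
  shows "p \<cdot>\<^bsub>N\<^esub> f = \<zero>\<^bsub>N\<^esub>"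
proof
  fix k
  show "(p \<cdot>\<^bsub>N\<^esub> f) k = \<zero>\<^bsub>N\<^esub> k"
    unfolding N_coeff zero_N using assms
    by (intro M.finsum_eq_zero) (simp add: pow_compatible up_coeff_closed)
qed

lemma rsmult_coeffs_closed:
  assumes "p \<in> up M" "g \<in> up R"
  shows "(p \<cdot>\<^bsub>N\<^esub> g) k \<in> carrier M"
  unfolding N_coeff using assms
  by (intro M.finsum_closed) (auto intro!: rsmult_closed simp: up_coeff_closed)

text \<open>Each coefficient of \<open>p g\<close> is a sum of terms \<open>p i r\<close> with
  \<open>r\<close> in R, and semicommutativity lets \<open>f j\<close> kill every such term.\<close>

lemma cyclic_annihilated_if_coeffs:
  assumes p: "p \<in> up M" and f: "f \<in> up R" and g: "g \<in> up R"
    and z: "\<And>i j. p i \<cdot>\<^bsub>M\<^esub> f j = \<zero>\<^bsub>M\<^esub>"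
  shows "p \<cdot>\<^bsub>N\<^esub> g \<cdot>\<^bsub>N\<^esub> f = \<zero>\<^bsub>N\<^esub>"
proof (rule rsmult_eq_zero_if_coeffs)
  show "(p \<cdot>\<^bsub>N\<^esub> g) k \<in> carrier M" for k
    using p g by (rule rsmult_coeffs_closed)
  show "(p \<cdot>\<^bsub>N\<^esub> g) k \<cdot>\<^bsub>M\<^esub> f j = \<zero>\<^bsub>M\<^esub>" for k j
  proof -
    have "(p \<cdot>\<^bsub>N\<^esub> g) k \<cdot>\<^bsub>M\<^esub> f j
      = (\<Oplus>\<^bsub>M\<^esub>i\<in>{..k}. p i \<cdot>\<^bsub>M\<^esub> (\<sigma> ^^ i) (g (k - i)) \<cdot>\<^bsub>M\<^esub> f j)"
      unfolding N_coeff using p f g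
      by (intro finsum_rsmult) (auto intro!: rsmult_closed simp: up_coeff_closed)
    also have "\<dots> = \<zero>\<^bsub>M\<^esub>"
      using p f g z by (intro M.finsum_eq_zero insert_factor) (simp_all add: up_coeff_closed)
    finally show ?thesis .
  qed
qed (fact f)

section \<open>Annihilators of elements and of cyclic submodules\<close>

lemma right_ann_cyclic:
  assumes "n \<in> carrier M"
  shows "right_ann R M (cyclic_submodule R M n) = right_ann R M {n}"
proof -
  have "n = n \<cdot>\<^bsub>M\<^esub> \<one>\<^bsub>R\<^esub>" using assms by (simp add: rsmult_one)
  then show ?thesis
    using assms insert_factor unfolding right_ann_def cyclic_submodule_def by fastforce
qed

lemma pp_iff_pq_Baer: "pp_module R M \<longleftrightarrow> pq_Baer_module R M"
  by (simp add: pp_module_def pq_Baer_module_def right_ann_cyclic)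

text \<open>The Armendariz property of \<open>p\<close> is a hypothesis because it has two sources:
  \<open>const_annihilator_coeffs\<close> for constants, and \<open>armendariz\<close> for all
  \<open>p\<close> when M is p.p.\<close>

lemma right_ann_skew_cyclic:
  assumes p: "p \<in> up M"
    and arm: "\<And>f i j. f \<in> up R \<Longrightarrow> p \<cdot>\<^bsub>N\<^esub> f = \<zero>\<^bsub>N\<^esub> \<Longrightarrow> p i \<cdot>\<^bsub>M\<^esub> f j = \<zero>\<^bsub>M\<^esub>"
  shows "right_ann S N (cyclic_submodule S N p) = right_ann S N {p}"
proof
  have "const_poly R \<one>\<^bsub>R\<^esub> \<in> up R" by (simp add: const_poly_closed)
  then have "p \<in> cyclic_submodule S N p"
    unfolding cyclic_submodule_def using rsmult_const_one[OF p]
    by (metis (mono_tags, lifting) carrier_S mem_Collect_eq)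
  then show "right_ann S N (cyclic_submodule S N p) \<subseteq> right_ann S N {p}"
    by (auto simp: right_ann_def)
  show "right_ann S N {p} \<subseteq> right_ann S N (cyclic_submodule S N p)"
    using cyclic_annihilated_if_coeffs[OF p] arm
    by (auto simp: right_ann_def cyclic_submodule_def)
qed

section \<open>Descent from M[x;\<sigma>] to M\<close>

text \<open>For a constant the product has coefficients \<open>m f j\<close>, with no sum and no
  twist. This makes the Armendariz property available before M is known to be p.p.\<close>

lemma const_annihilator_coeffs:
  assumes m: "m \<in> carrier M" and f: "f \<in> up R"
    and "const_poly M m \<cdot>\<^bsub>N\<^esub> f = \<zero>\<^bsub>N\<^esub>"
  shows "const_poly M m i \<cdot>\<^bsub>M\<^esub> f j = \<zero>\<^bsub>M\<^esub>"
proof -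
  have "m \<cdot>\<^bsub>M\<^esub> f j = \<zero>\<^bsub>M\<^esub>"
    using const_rsmult_coeff[OF m f, of j] assms(3) by (simp add: zero_N)
  then show ?thesis
    using f by (simp add: const_poly_def up_coeff_closed)
qed

text \<open>Taking constant terms is multiplicative, so idempotency and generation pass from
  \<open>e\<close> to \<open>e 0\<close>. Only constants occur in the hypothesis, which both p.p.
  and p.q.-Baer of M[x;\<sigma>] can supply.\<close>

lemma pp_if_const_annihilators:
  assumes "\<And>m. m \<in> carrier M \<Longrightarrow> \<exists>e\<in>carrier S. e \<otimes>\<^bsub>S\<^esub> e = e \<and>
      right_ann S N {const_poly M m} = e <#\<^bsub>S\<^esub> carrier S"
  shows "pp_module R M"
  unfolding pp_module_def
proof
  fix m assume m: "m \<in> carrier M"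
  then obtain e where e: "e \<in> up R" "e \<otimes>\<^bsub>S\<^esub> e = e"
    and ann: "right_ann S N {const_poly M m} = e <#\<^bsub>S\<^esub> up R"
    using assms[OF m] by auto
  have e0: "e 0 \<in> carrier R" using e by (simp add: up_coeff_closed)
  have "e \<in> right_ann S N {const_poly M m}"
    unfolding ann l_coset_def using e by force
  then have "(const_poly M m \<cdot>\<^bsub>N\<^esub> e) 0 = \<zero>\<^bsub>M\<^esub>"
    by (simp add: right_ann_def zero_N)
  then have me: "m \<cdot>\<^bsub>M\<^esub> e 0 = \<zero>\<^bsub>M\<^esub>"
    using const_rsmult_coeff[OF m e(1)] by simp
  have "right_ann R M {m} = e 0 <#\<^bsub>R\<^esub> carrier R"
  proof
    show "e 0 <#\<^bsub>R\<^esub> carrier R \<subseteq> right_ann R M {m}"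
      using m e0 me by (auto simp: l_coset_def right_ann_def rsmult_assoc)
    show "right_ann R M {m} \<subseteq> e 0 <#\<^bsub>R\<^esub> carrier R"
    proof
      fix a assume "a \<in> right_ann R M {m}"
      then have a: "a \<in> carrier R" "m \<cdot>\<^bsub>M\<^esub> a = \<zero>\<^bsub>M\<^esub>" by (auto simp: right_ann_def)
      then have "const_poly M m \<cdot>\<^bsub>N\<^esub> const_poly R a = \<zero>\<^bsub>N\<^esub>"
        using m by (intro rsmult_eq_zero_if_coeffs)
          (auto simp: const_poly_closed, auto simp: const_poly_def)
      then have "const_poly R a \<in> e <#\<^bsub>S\<^esub> up R"
        using a by (auto simp flip: ann simp: right_ann_def const_poly_closed)
      then obtain g where g: "g \<in> up R" "const_poly R a = e \<otimes>\<^bsub>S\<^esub> g"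
        by (auto simp: l_coset_def)
      \<comment> \<open>Compare the constant terms of both sides.\<close>
      then have "a = e 0 \<otimes>\<^bsub>R\<^esub> g 0"
        using mult_coeff_0[OF e(1) g(1)] by (simp flip: g(2) add: const_poly_def)
      then show "a \<in> e 0 <#\<^bsub>R\<^esub> carrier R"
        using g(1) by (auto simp: l_coset_def up_coeff_closed)
    qed
  qed
  moreover have "e 0 \<otimes>\<^bsub>R\<^esub> e 0 = e 0"
    using mult_coeff_0[OF e(1) e(1)] e(2) by simp
  ultimately show "\<exists>e\<in>carrier R. e \<otimes>\<^bsub>R\<^esub> e = e \<and> right_ann R M {m} = e <#\<^bsub>R\<^esub> carrier R"
    using e0 by blast
qed

lemma pp_if_skew_pp: "pp_module S N \<Longrightarrow> pp_module R M"
  by (rule pp_if_const_annihilators) (simp add: pp_module_def const_poly_closed)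

lemma pp_if_skew_pq_Baer:
  assumes "pq_Baer_module S N"
  shows "pp_module R M"
proof (rule pp_if_const_annihilators)
  fix m assume m: "m \<in> carrier M"
  then have p: "const_poly M m \<in> up M" by (simp add: const_poly_closed)
  show "\<exists>e\<in>carrier S. e \<otimes>\<^bsub>S\<^esub> e = e \<and>
      right_ann S N {const_poly M m} = e <#\<^bsub>S\<^esub> carrier S"
    using bspec[OF assms[unfolded pq_Baer_module_def], of "const_poly M m"] p
      right_ann_skew_cyclic[OF p] const_annihilator_coeffs[OF m]
    by simp
qed

section \<open>The Armendariz property\<close>

text \<open>For idempotent \<open>e\<close>, membership of \<open>a\<close> in the right ideal
  \<open>e R\<close> is the equation \<open>e a = a\<close>; later arguments use this equational
  form.\<close>

lemma annihilator_generatorE: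
  assumes "pp_module R M" "m \<in> carrier M"
  obtains e where "e \<in> carrier R" "e \<otimes>\<^bsub>R\<^esub> e = e"
    "\<And>a. a \<in> carrier R \<Longrightarrow> m \<cdot>\<^bsub>M\<^esub> a = \<zero>\<^bsub>M\<^esub> \<longleftrightarrow> e \<otimes>\<^bsub>R\<^esub> a = a"
proof -
  obtain e where e: "e \<in> carrier R" "e \<otimes>\<^bsub>R\<^esub> e = e"
    and ann: "right_ann R M {m} = e <#\<^bsub>R\<^esub> carrier R"
    using assms by (auto simp: pp_module_def)
  have "m \<cdot>\<^bsub>M\<^esub> a = \<zero>\<^bsub>M\<^esub> \<longleftrightarrow> e \<otimes>\<^bsub>R\<^esub> a = a" if a: "a \<in> carrier R" for a
  proof -
    have "m \<cdot>\<^bsub>M\<^esub> a = \<zero>\<^bsub>M\<^esub> \<longleftrightarrow> a \<in> e <#\<^bsub>R\<^esub> carrier R"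
      using a by (simp flip: ann add: right_ann_def)
    also have "\<dots> \<longleftrightarrow> (\<exists>b\<in>carrier R. a = e \<otimes>\<^bsub>R\<^esub> b)"
      by (auto simp: l_coset_def)
    also have "\<dots> \<longleftrightarrow> e \<otimes>\<^bsub>R\<^esub> a = a"
      using e a by (metis R.m_assoc)
    finally show ?thesis .
  qed
  with e that show thesis by blast
qed

text \<open>Strong induction on the degree \<open>k\<close>, and within it on the position
  \<open>i\<close> in the coefficient of degree \<open>k\<close>: lower degrees control the summands
  after \<open>i\<close>, and the inner hypothesis those before it.\<close>

lemma armendariz:
  assumes pp: "pp_module R M" and p: "p \<in> up M" and f: "f \<in> up R"
    and z: "p \<cdot>\<^bsub>N\<^esub> f = \<zero>\<^bsub>N\<^esub>"
  shows "p i \<cdot>\<^bsub>M\<^esub> f j = \<zero>\<^bsub>M\<^esub>"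
proof -
  have pc: "p i \<in> carrier M" and fc: "f i \<in> carrier R" for i
    using p f by (auto simp: up_coeff_closed)
  have "\<forall>i\<le>k. p i \<cdot>\<^bsub>M\<^esub> f (k - i) = \<zero>\<^bsub>M\<^esub>" for k
  proof (induction k rule: less_induct)
    case (less k)
    have IH: "p i \<cdot>\<^bsub>M\<^esub> f j = \<zero>\<^bsub>M\<^esub>" if "i + j < k" for i j
      using less[OF that, rule_format, of i] by simp
    define t where "t j = p j \<cdot>\<^bsub>M\<^esub> (\<sigma> ^^ j) (f (k - j))" for j
    have tc: "t j \<in> carrier M" for j
      by (simp add: t_def pc fc rsmult_closed)
    have sum: "(\<Oplus>\<^bsub>M\<^esub>j\<in>{..k}. t j) = \<zero>\<^bsub>M\<^esub>"
      using fun_cong[OF z, of k] by (simp add: N_coeff zero_N t_def)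
    have "i \<le> k \<longrightarrow> t i = \<zero>\<^bsub>M\<^esub>" for i
    proof (induction i rule: less_induct)
      case (less i)
      show ?case
      proof
        assume ik: "i \<le> k"
        obtain e where e: "e \<in> carrier R" "e \<otimes>\<^bsub>R\<^esub> e = e"
          and ann: "\<And>a. a \<in> carrier R \<Longrightarrow> p i \<cdot>\<^bsub>M\<^esub> a = \<zero>\<^bsub>M\<^esub> \<longleftrightarrow> e \<otimes>\<^bsub>R\<^esub> a = a"
          using annihilator_generatorE[OF pp pc] by blast
        have pe: "p i \<cdot>\<^bsub>M\<^esub> e = \<zero>\<^bsub>M\<^esub>" using ann e by blast
        have ti: "t i \<cdot>\<^bsub>M\<^esub> e = \<zero>\<^bsub>M\<^esub>"
          unfolding t_def using pe e by (intro insert_factor) (simp_all add: pc fc)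
        \<comment> \<open>The idempotent \<open>e\<close> kills \<open>t i\<close> and fixes every later summand, so multiplying the vanishing
          sum by \<open>e\<close> leaves the sum of the later summands.\<close>
        have tj: "t j \<cdot>\<^bsub>M\<^esub> e = t j" if "i < j" "j \<le> k" for j
        proof -
          let ?b = "(\<sigma> ^^ j) (f (k - j))"
          have b: "?b \<in> carrier R" by (simp add: fc)
          \<comment> \<open>The outer hypothesis applies because \<open>i < j\<close> and
            \<open>j \<le> k\<close> give \<open>i + (k - j) < k\<close>.\<close>
          have "p i \<cdot>\<^bsub>M\<^esub> f (k - j) = \<zero>\<^bsub>M\<^esub>"
            using that by (intro IH) simp
          \<comment> \<open>Compatibility carries the annihilation over to \<open>?b\<close>.
            Centrality then gives \<open>p j ?b e = p j e ?b = p j ?b\<close>.\<close>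
          then have "e \<otimes>\<^bsub>R\<^esub> ?b = ?b"
            using ann[OF b] by (simp add: pow_compatible pc fc)
          then show ?thesis
            unfolding t_def idempotent_acts_centrally[OF pc b e]
            using rsmult_assoc[OF pc e(1) b] by metis
        qed
        \<comment> \<open>For \<open>j < i\<close> both sides are zero by the inner
          hypothesis.\<close>
        have "t j \<cdot>\<^bsub>M\<^esub> e = t j" if "j \<in> {..k} - {i}" for j
        proof (cases "j < i")
          case True
          then show ?thesis using less ik e by simp
        next
          case False
          then show ?thesis using that tj by auto
        qed
        then have rest: "(\<Oplus>\<^bsub>M\<^esub>j\<in>{..k} - {i}. t j) = (\<Oplus>\<^bsub>M\<^esub>j\<in>{..k} - {i}. t j \<cdot>\<^bsub>M\<^esub> e)"
          using tc by (intro M.finsum_cong') auto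
        have ins: "{..k} = insert i ({..k} - {i})" using ik by auto
        have "\<zero>\<^bsub>M\<^esub> = (\<Oplus>\<^bsub>M\<^esub>j\<in>{..k}. t j \<cdot>\<^bsub>M\<^esub> e)"
          using finsum_rsmult[OF e(1), of "{..k}" t] tc sum e by simp
        also have "\<dots> = t i \<cdot>\<^bsub>M\<^esub> e \<oplus>\<^bsub>M\<^esub> (\<Oplus>\<^bsub>M\<^esub>j\<in>{..k} - {i}. t j \<cdot>\<^bsub>M\<^esub> e)"
          by (subst ins, subst M.finsum_insert) (auto simp: tc e rsmult_closed)
        also have "\<dots> = (\<Oplus>\<^bsub>M\<^esub>j\<in>{..k} - {i}. t j)"
          using tc by (simp add: ti rest[symmetric])
        finally have rest0: "(\<Oplus>\<^bsub>M\<^esub>j\<in>{..k} - {i}. t j) = \<zero>\<^bsub>M\<^esub>" by simp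
        have "(\<Oplus>\<^bsub>M\<^esub>j\<in>{..k}. t j) = t i \<oplus>\<^bsub>M\<^esub> (\<Oplus>\<^bsub>M\<^esub>j\<in>{..k} - {i}. t j)"
          by (subst ins, subst M.finsum_insert) (auto simp: tc)
        then show "t i = \<zero>\<^bsub>M\<^esub>" using sum rest0 tc by simp
      qed
    qed
    \<comment> \<open>Compatibility strips the power of \<sigma> from
      \<open>t i = 0\<close>.\<close>
    then show ?case
      unfolding t_def by (simp add: pow_compatible pc fc)
  qed
  from this[of "i + j", rule_format, of i] show ?thesis by simp
qed

section \<open>Ascent from M to M[x;\<sigma>]\<close>

text \<open>Idempotents \<open>e\<close> and \<open>d\<close> need not commute in R, but
  semicommutativity makes \<open>d R\<close> two-sided, so \<open>d (e d) = e d\<close>. Hence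
  \<open>e d\<close> is idempotent and generates the intersection of \<open>e R\<close> and
  \<open>d R\<close>.\<close>

lemma finite_annihilator_generator:
  assumes pp: "pp_module R M" and p: "\<And>i. p i \<in> carrier M"
  shows "\<exists>e\<in>carrier R. e \<otimes>\<^bsub>R\<^esub> e = e \<and>
    (\<forall>a\<in>carrier R. (\<forall>i<n::nat. p i \<cdot>\<^bsub>M\<^esub> a = \<zero>\<^bsub>M\<^esub>) \<longleftrightarrow> e \<otimes>\<^bsub>R\<^esub> a = a)"
proof (induction n)
  case 0
  \<comment> \<open>The empty intersection is R itself, generated by 1.\<close>
  show ?case by (rule bexI[of _ "\<one>\<^bsub>R\<^esub>"]) auto
next
  case (Suc n)
  then obtain e where e: "e \<in> carrier R" "e \<otimes>\<^bsub>R\<^esub> e = e"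
    and ann_e: "\<And>a. a \<in> carrier R \<Longrightarrow> (\<forall>i<n. p i \<cdot>\<^bsub>M\<^esub> a = \<zero>\<^bsub>M\<^esub>) \<longleftrightarrow> e \<otimes>\<^bsub>R\<^esub> a = a"
    by blast
  obtain d where d: "d \<in> carrier R" "d \<otimes>\<^bsub>R\<^esub> d = d"
    and ann_d: "\<And>a. a \<in> carrier R \<Longrightarrow> p n \<cdot>\<^bsub>M\<^esub> a = \<zero>\<^bsub>M\<^esub> \<longleftrightarrow> d \<otimes>\<^bsub>R\<^esub> a = a"
    using annihilator_generatorE[OF pp p] by blast
  let ?g = "e \<otimes>\<^bsub>R\<^esub> d"
  have g: "?g \<in> carrier R" using e d by simp
  have eg: "e \<otimes>\<^bsub>R\<^esub> ?g = ?g" using e d by (metis R.m_assoc)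
  \<comment> \<open>\<open>r(p n) = dR\<close> is also a left ideal.\<close>
  have "p n \<cdot>\<^bsub>M\<^esub> d = \<zero>\<^bsub>M\<^esub>" using ann_d d by blast
  then have "p n \<cdot>\<^bsub>M\<^esub> ?g = \<zero>\<^bsub>M\<^esub>" using insert_factor e d p by (simp add: rsmult_assoc)
  then have dg: "d \<otimes>\<^bsub>R\<^esub> ?g = ?g" using ann_d g by blast
  have "(\<forall>i<Suc n. p i \<cdot>\<^bsub>M\<^esub> a = \<zero>\<^bsub>M\<^esub>) \<longleftrightarrow> ?g \<otimes>\<^bsub>R\<^esub> a = a" if a: "a \<in> carrier R" for a
  proof -
    have "(\<forall>i<Suc n. p i \<cdot>\<^bsub>M\<^esub> a = \<zero>\<^bsub>M\<^esub>) \<longleftrightarrow> e \<otimes>\<^bsub>R\<^esub> a = a \<and> d \<otimes>\<^bsub>R\<^esub> a = a"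
      using ann_e[OF a] ann_d[OF a] by (auto simp: less_Suc_eq)
    also have "\<dots> \<longleftrightarrow> ?g \<otimes>\<^bsub>R\<^esub> a = a"
      using R.m_assoc[OF e(1) d(1) a] R.m_assoc[OF e(1) g a] R.m_assoc[OF d(1) g a] eg dg
      by metis
    finally show ?thesis .
  qed
  moreover have "?g \<otimes>\<^bsub>R\<^esub> ?g = ?g"
    using R.m_assoc[OF e(1) d(1) g] eg dg by simp
  ultimately show ?case using g by blast
qed

text \<open>Left multiplication by a constant involves no power of \<sigma>, so \<open>f\<close>
  lies in the right ideal of the constant \<open>e\<close> exactly when \<open>e\<close> fixes every
  coefficient of \<open>f\<close> from the left.\<close>

lemma skew_annihilator:
  assumes pp: "pp_module R M" and p: "p \<in> up M"
  shows "\<exists>e\<in>carrier S. e \<otimes>\<^bsub>S\<^esub> e = e \<and> right_ann S N {p} = e <#\<^bsub>S\<^esub> carrier S"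
proof -
  have pc: "p i \<in> carrier M" for i using p by (simp add: up_coeff_closed)
  obtain n where n: "\<And>i. n < i \<Longrightarrow> p i = \<zero>\<^bsub>M\<^esub>"
    using up_boundE[OF p] by blast
  \<comment> \<open>The bound \<open>n\<close> is inclusive: \<open>p n\<close> may be nonzero,
    hence \<open>Suc n\<close> coefficients.\<close>
  obtain e where e: "e \<in> carrier R" "e \<otimes>\<^bsub>R\<^esub> e = e"
    and ann: "\<And>a. a \<in> carrier R \<Longrightarrow> (\<forall>i<Suc n. p i \<cdot>\<^bsub>M\<^esub> a = \<zero>\<^bsub>M\<^esub>) \<longleftrightarrow> e \<otimes>\<^bsub>R\<^esub> a = a"
    using finite_annihilator_generator[where p = p and n = "Suc n", OF pp pc] by metis
  have ann': "(\<forall>i. p i \<cdot>\<^bsub>M\<^esub> a = \<zero>\<^bsub>M\<^esub>) \<longleftrightarrow> e \<otimes>\<^bsub>R\<^esub> a = a" if a: "a \<in> carrier R" for a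
    unfolding ann[OF a, symmetric] using n a
    by (metis not_less_eq zero_rsmult)
  let ?e = "const_poly R e"
  have ec: "?e \<in> up R" using e by (simp add: const_poly_closed)
  have "(?e \<otimes>\<^bsub>S\<^esub> ?e) k = ?e k" for k
    using e by (simp add: const_mult_coeff ec, simp add: const_poly_def)
  then have ee: "?e \<otimes>\<^bsub>S\<^esub> ?e = ?e" by blast
  have "right_ann S N {p} = ?e <#\<^bsub>S\<^esub> up R"
  proof
    show "right_ann S N {p} \<subseteq> ?e <#\<^bsub>S\<^esub> up R"
    proof
      fix f assume "f \<in> right_ann S N {p}"
      then have f: "f \<in> up R" "p \<cdot>\<^bsub>N\<^esub> f = \<zero>\<^bsub>N\<^esub>" by (auto simp: right_ann_def)
      then have "e \<otimes>\<^bsub>R\<^esub> f k = f k" for k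
        using armendariz[OF pp p f] ann'[of "f k"] by (simp add: up_coeff_closed)
      then have "?e \<otimes>\<^bsub>S\<^esub> f = f"
        using e f by (auto simp: const_mult_coeff)
      then show "f \<in> ?e <#\<^bsub>S\<^esub> up R" using f(1) by (force simp: l_coset_def)
    qed
    show "?e <#\<^bsub>S\<^esub> up R \<subseteq> right_ann S N {p}"
    proof
      fix f assume "f \<in> ?e <#\<^bsub>S\<^esub> up R"
      then obtain g where g: "g \<in> up R" "f = ?e \<otimes>\<^bsub>S\<^esub> g" by (auto simp: l_coset_def)
      have gc: "g k \<in> carrier R" for k using g by (simp add: up_coeff_closed)
      have fk: "f k = e \<otimes>\<^bsub>R\<^esub> g k" for k using g e by (simp add: const_mult_coeff)
      obtain b where b: "\<And>k. b < k \<Longrightarrow> g k = \<zero>\<^bsub>R\<^esub>"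
        using up_boundE[OF g(1)] by blast
      \<comment> \<open>Finite support is checked directly: left multiplication by \<open>e\<close>
        preserves the bound of \<open>g\<close>.\<close>
      then have f: "f \<in> up R"
        using e gc b by (auto simp: fk up_def bound_def intro!: exI[of _ b])
      have "e \<otimes>\<^bsub>R\<^esub> f k = f k" for k
        using R.m_assoc[OF e(1) e(1) gc] e by (simp add: fk)
      then have "p \<cdot>\<^bsub>N\<^esub> f = \<zero>\<^bsub>N\<^esub>"
        using ann' f by (intro rsmult_eq_zero_if_coeffs) (auto simp: pc up_coeff_closed)
      then show "f \<in> right_ann S N {p}" using f by (simp add: right_ann_def)
    qed
  qed
  with ee ec show ?thesis by auto
qed

lemma skew_pp_if_pp: "pp_module R M \<Longrightarrow> pp_module S N"
  unfolding pp_module_def[of S N] using skew_annihilator by simp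

lemma skew_pq_Baer_if_pp:
  assumes "pp_module R M"
  shows "pq_Baer_module S N"
  unfolding pq_Baer_module_def
proof
  fix p assume "p \<in> carrier N"
  then have p: "p \<in> up M" by simp
  have eq: "right_ann S N (cyclic_submodule S N p) = right_ann S N {p}"
    by (rule right_ann_skew_cyclic) (fact p, rule armendariz[OF assms p])
  show "\<exists>e\<in>carrier S. e \<otimes>\<^bsub>S\<^esub> e = e \<and>
      right_ann S N (cyclic_submodule S N p) = e <#\<^bsub>S\<^esub> carrier S"
    unfolding eq
    using assms p by (rule skew_annihilator)
qed

end

theorem theorem3p6:
  fixes R :: "('r, 'b) ring_scheme"
    and M :: "('r, 'm, 'c) rmodule_scheme"
    and \<sigma> :: "'r \<Rightarrow> 'r"
  assumes "right_module R M"
    and "\<sigma> \<in> ring_hom R R"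
    and "semicommutative_module R M"
    and "compatible_module R \<sigma> M"
  shows "(pp_module R M \<longleftrightarrow> pq_Baer_module R M)
    \<and> (pq_Baer_module R M \<longleftrightarrow> pp_module (skew_poly_ring R \<sigma>) (skew_poly_module \<sigma> M))
    \<and> (pp_module (skew_poly_ring R \<sigma>) (skew_poly_module \<sigma> M)
        \<longleftrightarrow> pq_Baer_module (skew_poly_ring R \<sigma>) (skew_poly_module \<sigma> M))"
proof -
  interpret semicommutative_compatible_module R M \<sigma>
    using assms
    by (simp add: semicommutative_compatible_module_def semicommutative_compatible_module_axioms_def)
  \<comment> \<open>All equivalences pass through p.p. of M, which is equivalent to each of the
    other three conditions.\<close>
  show ?thesis
    using pp_iff_pq_Baer pp_if_skew_pp pp_if_skew_pq_Baer skew_pp_if_pp skew_pq_Baer_if_pp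
    by blast
qed

end
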